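(* Let $c\in C^1(\mathbb{R})$ and let $u=u(t,x;\omega)$ be the solution of the linear scalar transport equation with random initial data $$\partial_t u(t,x;\omega)=c(x)\,\partial_x u(t,x;\omega),\qquad u(0,x;\omega)=u_{(0,x)}(\omega).$$ Let $f(t,x,\cdot)$ denote the probability density function of the pointwise statistics $\phi_{t,x}=u(t,x;\cdot)_\sharp\mu$, and let $f_0(x,\cdot)$ denote the probability density function of $\phi_{0,x}$. Assume that $x\mapsto f_0(x,U)$ is piecewise $C^1$ for every $U\in\mathbb{R}$. Then $f$ satisfies $$\begin{cases}\partial_t f(t,x,U)=c(x)\,\partial_x f(t,x,U),\\ f(0,x,U)=f_0(x,U).\end{cases}$$
   Context: $\Omega\subseteq\mathbb{R}^d$ is equipped with a Borel probability measure $\mu$. For every $x\in\mathbb{R}$ the initial datum $u_{(0,x)}:\Omega\to\mathbb{R}$ is measurable, and the initial data are regular enough that the initial value problem has a unique solution (a sufficient condition is that $x\mapsto u_{(0,x)}(\omega)$ is piecewise $C^1$ and $c\in C^1(\mathbb{R})$). For fixed $(t,x)$, the pointwise statistics $\phi_{t,x}$ is the pushforward probability measure on $\mathbb{R}$ given by $\phi_{t,x}(A)=\mu(\{\omega\in\Omega: u(t,x;\omega)\in A\})$ for all Borel $A\subseteq\mathbb{R}$. The variable $U\in\mathbb{R}$ is the argument of the density, i.e. the value taken by $u$. *)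

theory Defs
  imports "HOL-Probability.Probability"
begin

text \<open>
  Piecewise \<open>C\<^sup>1\<close> functions on the line, jumps allowed.  The breakpoints may be infinitely many
  as long as they do not accumulate.  The values at the breakpoints are arbitrary.
\<close>

definition locally_finite_set :: "real set \<Rightarrow> bool" where
  "locally_finite_set D \<longleftrightarrow> (\<forall>a b. finite (D \<inter> {a..b}))"

definition piecewise_C1 :: "(real \<Rightarrow> real) \<Rightarrow> bool" where
  "piecewise_C1 g \<longleftrightarrow> (\<exists>D. locally_finite_set D \<and> g C1_differentiable_on (UNIV - D))"

text \<open>The library's notion is the special case of a continuous function with finitely many
  breakpoints.\<close>

lemma piecewise_C1_differentiable_on_imp_piecewise_C1:
  "g piecewise_C1_differentiable_on UNIV \<Longrightarrow> piecewise_C1 g"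
  unfolding piecewise_C1_differentiable_on_def piecewise_C1_def locally_finite_set_def
  by blast

text \<open>
  The operator \<open>\<partial>\<^sub>t - c(x) \<partial>\<^sub>x\<close> is the derivative in direction \<open>(1, -c(x))\<close>, whence the sign below.
  A characteristic is only required to exist up to the time \<open>T\<close>: for general \<open>c\<close> it may leave every
  compact set in finite time.
\<close>

definition characteristic :: "(real \<Rightarrow> real) \<Rightarrow> real \<Rightarrow> (real \<Rightarrow> real) \<Rightarrow> bool" where
  "characteristic c T \<gamma> \<longleftrightarrow>
     (\<forall>s\<in>{0..T}. (\<gamma> has_real_derivative - c (\<gamma> s)) (at s within {0..T}))"

text \<open>The part of the half-plane \<open>t \<ge> 0\<close> covered by characteristics issuing from \<open>D\<close> at time 0.\<close>

definition singular_set :: "(real \<Rightarrow> real) \<Rightarrow> real set \<Rightarrow> (real \<times> real) set" where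
  "singular_set c D = {(t, \<gamma> t) | t \<gamma>. 0 \<le> t \<and> characteristic c t \<gamma> \<and> \<gamma> 0 \<in> D}"

text \<open>
  \<open>v\<close> is of class \<open>C\<^sup>1\<close> (one-sidedly in \<open>t\<close> at \<open>t = 0\<close>) and satisfies \<open>\<partial>\<^sub>t v = c(x) \<partial>\<^sub>x v\<close> on \<open>S\<close>.
\<close>

definition classical_transport_on ::
    "(real \<Rightarrow> real) \<Rightarrow> (real \<times> real) set \<Rightarrow> (real \<Rightarrow> real \<Rightarrow> real) \<Rightarrow> bool" where
  "classical_transport_on c S v \<longleftrightarrow>
     (\<exists>vt vx.
        continuous_on S (\<lambda>(t, x). vt t x) \<and> continuous_on S (\<lambda>(t, x). vx t x) \<and>
        (\<forall>(t, x)\<in>S.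
           ((\<lambda>s. v s x) has_real_derivative vt t x) (at t within {0..}) \<and>
           ((\<lambda>y. v t y) has_real_derivative vx t x) (at x) \<and>
           vt t x = c x * vx t x))"

text \<open>
  Piecewise \<open>C\<^sup>1\<close> solution on \<open>t \<ge> 0\<close> with initial datum \<open>v0\<close>: classical away from the
  characteristics that issue from the breakpoints.  On those the partial derivatives need not
  exist.  Since a jump or kink of a solution can only travel along a characteristic, the equation
  is required there for the derivative along the curve, \<open>d/dt v(t, \<gamma>(t)) = 0\<close>; this also fixes
  the value of \<open>v\<close> on the curve.  For \<open>D = {}\<close> this is a classical solution.
  Values \<open>v t x\<close> with \<open>t < 0\<close> are irrelevant.
\<close>

definition transport_solution ::
    "(real \<Rightarrow> real) \<Rightarrow> (real \<Rightarrow> real) \<Rightarrow> (real \<Rightarrow> real \<Rightarrow> real) \<Rightarrow> bool" where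
  "transport_solution c v0 v \<longleftrightarrow>
     (\<forall>x. v 0 x = v0 x) \<and>
     (\<exists>D. locally_finite_set D \<and>
          classical_transport_on c ({0..} \<times> UNIV - singular_set c D) v \<and>
          (\<forall>T \<gamma>. 0 \<le> T \<longrightarrow> characteristic c T \<gamma> \<longrightarrow> \<gamma> 0 \<in> D \<longrightarrow>
             (\<forall>s\<in>{0..T}. ((\<lambda>s. v s (\<gamma> s)) has_real_derivative 0) (at s within {0..T}))))"

definition unique_transport_solution ::
    "(real \<Rightarrow> real) \<Rightarrow> (real \<Rightarrow> real) \<Rightarrow> (real \<Rightarrow> real \<Rightarrow> real) \<Rightarrow> bool" where
  "unique_transport_solution c v0 v \<longleftrightarrow>
     transport_solution c v0 v \<and>
     (\<forall>w. transport_solution c v0 w \<longrightarrow> (\<forall>t\<ge>0. \<forall>x. w t x = v t x))"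

definition pointwise_statistics ::
    "'a measure \<Rightarrow> (real \<Rightarrow> real \<Rightarrow> 'a \<Rightarrow> real) \<Rightarrow> real \<Rightarrow> real \<Rightarrow> real measure" where
  "pointwise_statistics M u t x = distr M borel (u t x)"

definition is_pdf :: "real measure \<Rightarrow> (real \<Rightarrow> real) \<Rightarrow> bool" where
  "is_pdf \<phi> g \<longleftrightarrow>
     g \<in> borel_measurable borel \<and> (\<forall>U. 0 \<le> g U) \<and> \<phi> = density lborel (\<lambda>U. ennreal (g U))"

text \<open>
  Densities are determined only up to Lebesgue null sets in \<open>U\<close>, separately for each \<open>(t, x)\<close>.
\<close>

definition is_pdf_family ::
    "'a measure \<Rightarrow> (real \<Rightarrow> real \<Rightarrow> 'a \<Rightarrow> real) \<Rightarrow> (real \<Rightarrow> real \<Rightarrow> real \<Rightarrow> real) \<Rightarrow> bool" where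
  "is_pdf_family M u f \<longleftrightarrow> (\<forall>t\<ge>0. \<forall>x. is_pdf (pointwise_statistics M u t x) (f t x))"

end

theory Submission
  imports Defs
begin

text \<open>
  If the flow \<open>X t x\<close> of \<open>y' = c y\<close> is complete for \<open>t \<ge> 0\<close>, then \<open>X t x\<close> is the foot at time 0 of
  the characteristic through \<open>(t, x)\<close>, and \<open>\<partial>\<^sub>t X = c(X) = c(x) \<partial>\<^sub>x X\<close>.  Hence \<open>g (X t x)\<close> solves
  the transport equation for every piecewise \<open>C\<^sup>1\<close> datum \<open>g\<close>.  By uniqueness \<open>u t x = u0 (X t x)\<close>,
  so \<open>f0 (X t x)\<close> is a density of \<open>u t x\<close>, and it solves the equation by the same principle.

  Completeness comes from uniqueness too: if a trajectory of \<open>y' = c y\<close> escapes to infinity in finite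
  time, information enters from infinity, and there is a nonzero classical solution with zero
  initial datum, which can be added to any solution.
\<close>

section \<open>Trajectories, characteristics and time reversal\<close>

definition ode_solution :: "(real \<Rightarrow> real) \<Rightarrow> real \<Rightarrow> (real \<Rightarrow> real) \<Rightarrow> bool" where
  "ode_solution c T y \<longleftrightarrow>
     (\<forall>s\<in>{0..T}. (y has_real_derivative c (y s)) (at s within {0..T}))"

lemma ode_solutionD:
  "ode_solution c T y \<Longrightarrow> s \<in> {0..T} \<Longrightarrow> (y has_real_derivative c (y s)) (at s within {0..T})"
  by (auto simp: ode_solution_def)

lemma ode_solution_continuous_on: "ode_solution c T y \<Longrightarrow> continuous_on {0..T} y"
  unfolding ode_solution_def continuous_on_eq_continuous_within
  by (auto intro: DERIV_continuous)

lemma characteristic_subinterval: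
  "characteristic c T \<gamma> \<Longrightarrow> S \<le> T \<Longrightarrow> characteristic c S \<gamma>"
  unfolding characteristic_def
  by (meson DERIV_subset atLeastAtMost_iff atLeastatMost_subset_iff order.refl order_trans)

lemma has_real_derivative_reverse:
  fixes f :: "real \<Rightarrow> real"
  assumes "(f has_real_derivative d) (at (T - s) within {0..T})"
  shows "((\<lambda>s. f (T - s)) has_real_derivative - d) (at s within {0..T})"
proof -
  have *: "(-) T ` {0..T} = {0..T}"
    by simp
  have "((\<lambda>s. T - s) has_real_derivative - 1) (at s within {0..T})"
    by (auto intro!: derivative_eq_intros)
  from DERIV_image_chain[OF _ this, of f d] assms show ?thesis
    by (simp add: * o_def)
qed

text \<open>Characteristics run against the field, so reversing time on \<open>{0..T}\<close> gives
  a trajectory that starts at \<open>\<gamma> T\<close> and ends at the foot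
  \<open>\<gamma> 0\<close>.\<close>

lemma ode_solution_reverse_characteristic:
  assumes "characteristic c T \<gamma>"
  shows "ode_solution c T (\<lambda>s. \<gamma> (T - s))"
  unfolding ode_solution_def
proof
  fix s assume "s \<in> {0..T}"
  then have "(\<gamma> has_real_derivative - c (\<gamma> (T - s))) (at (T - s) within {0..T})"
    using assms by (auto simp: characteristic_def)
  from has_real_derivative_reverse[OF this]
  show "((\<lambda>s. \<gamma> (T - s)) has_real_derivative c (\<gamma> (T - s))) (at s within {0..T})"
    by simp
qed

lemma characteristic_reverse_ode_solution:
  assumes "ode_solution c T y"
  shows "characteristic c T (\<lambda>s. y (T - s))"
  unfolding characteristic_def
proof
  fix s assume "s \<in> {0..T}"
  then have "(y has_real_derivative c (y (T - s))) (at (T - s) within {0..T})"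
    using assms by (auto simp: ode_solution_def)
  from has_real_derivative_reverse[OF this]
  show "((\<lambda>s. y (T - s)) has_real_derivative - c (y (T - s))) (at s within {0..T})"
    by simp
qed

text \<open>Integrating factor: with \<open>P\<close> the primitive of \<open>p\<close>, the product
  of \<open>y\<close> and \<open>exp (- P)\<close> has derivative zero and hence keeps its value at
  time 0.\<close>

lemma linear_ode_solution:
  fixes y p :: "real \<Rightarrow> real"
  assumes y: "\<And>s. s \<in> {0..T} \<Longrightarrow> (y has_real_derivative p s * y s) (at s within {0..T})"
    and p: "continuous_on {0..T} p"
    and t: "t \<in> {0..T}"
  shows "y t = y 0 * exp (integral {0..t} p)"
proof -
  define P where "P = (\<lambda>t. integral {0..t} p)"
  have P: "(P has_real_derivative p s) (at s within {0..T})" if "s \<in> {0..T}" for s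
    unfolding P_def by (rule integral_has_real_derivative[OF p that])
  have "\<exists>k. \<forall>s\<in>{0..T}. y s * exp (- P s) = k"
  proof (rule has_field_derivative_zero_constant)
    fix s assume s: "s \<in> {0..T}"
    show "((\<lambda>s. y s * exp (- P s)) has_real_derivative 0) (at s within {0..T})"
      by (rule derivative_eq_intros y[OF s] P[OF s] refl | simp)+
  qed simp
  then obtain k where k: "\<And>s. s \<in> {0..T} \<Longrightarrow> y s * exp (- P s) = k"
    by blast
  have "P 0 = 0"
    by (simp add: P_def)
  with k[of 0] t have "k = y 0"
    by auto
  with k[OF t] show ?thesis
    by (simp add: P_def exp_minus field_simps)
qed

section \<open>Differences of trajectories of a continuously differentiable field\<close>

locale C1_field =
  fixes c c' :: "real \<Rightarrow> real"
  assumes deriv: "\<And>x. (c has_real_derivative c' x) (at x)"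
    and cont_deriv: "continuous_on UNIV c'"
begin

lemma continuous_on_field: "continuous_on A c"
  by (meson DERIV_isCont continuous_at_imp_continuous_on deriv)

text \<open>The difference quotient of \<open>c\<close>, extended continuously to the diagonal.  With it, the difference
  of two solutions satisfies a linear equation, which gives uniqueness, monotonicity and
  differentiability of the flow at once.\<close>

definition slope :: "real \<Rightarrow> real \<Rightarrow> real" where
  "slope a b = integral {0..1} (\<lambda>\<theta>. c' (a + \<theta> * (b - a)))"

lemma slope_diag [simp]: "slope a a = c' a"
  by (simp add: slope_def)

text \<open>Fundamental theorem of calculus along the segment from \<open>a\<close> to
  \<open>b\<close>. The parameter runs over \<open>{0..1}\<close> in either case, so the order of
  \<open>a\<close> and \<open>b\<close> is immaterial.\<close>

lemma slope_mult: "slope a b * (b - a) = c b - c a"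
proof -
  have "((\<lambda>\<theta>. c' (a + \<theta> * (b - a)) * (b - a)) has_integral
      c (a + 1 * (b - a)) - c (a + 0 * (b - a))) {0..1}"
    by (rule fundamental_theorem_of_calculus)
      (auto simp flip: has_real_derivative_iff_has_vector_derivative
        intro!: derivative_eq_intros DERIV_chain2[OF deriv])
  then have "integral {0..1} (\<lambda>\<theta>. c' (a + \<theta> * (b - a)) * (b - a)) = c b - c a"
    by (simp only: integral_unique mult_1 mult_zero_left add_0_right add_diff_cancel_left' diff_add_cancel add.commute[of a "b - a"])
  then show ?thesis
    unfolding slope_def integral_mult_left .
qed

lemma continuous_on_slope:
  assumes "continuous_on A f" "continuous_on A g"
  shows "continuous_on A (\<lambda>z. slope (f z) (g z))"
proof -
  have "continuous_on UNIV (\<lambda>p. integral (cbox 0 1) (\<lambda>\<theta>::real. c' (fst p + \<theta> * (snd p - fst p))))"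
    by (rule integral_continuous_on_param)
      (auto simp: case_prod_unfold intro!: continuous_intros continuous_on_compose2[OF cont_deriv])
  then have "continuous_on UNIV (\<lambda>p. slope (fst p) (snd p))"
    by (simp add: slope_def)
  from continuous_on_compose2[OF this, of A "\<lambda>z. (f z, g z)"] assms show ?thesis
    by (auto intro!: continuous_intros)
qed

lemma ode_solution_diff:
  assumes y: "ode_solution c T y" and z: "ode_solution c T z" and t: "t \<in> {0..T}"
  shows "z t - y t = (z 0 - y 0) * exp (integral {0..t} (\<lambda>s. slope (y s) (z s)))"
proof (rule linear_ode_solution[OF _ _ t, of "\<lambda>s. z s - y s"])
  fix s assume s: "s \<in> {0..T}"
  show "((\<lambda>s. z s - y s) has_real_derivative slope (y s) (z s) * (z s - y s)) (at s within {0..T})"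
    unfolding slope_mult by (intro DERIV_diff ode_solutionD[OF y s] ode_solutionD[OF z s])
qed (intro continuous_on_slope ode_solution_continuous_on[OF y] ode_solution_continuous_on[OF z])

end

section \<open>The forward complete flow and its regularity\<close>

text \<open>Completeness is forward in time only: for negative \<open>T\<close> the interval
  \<open>{0..T}\<close> is empty and \<open>flow_ode\<close> is vacuous. Each \<open>X t\<close>
  with \<open>t \<ge> 0\<close> is injective, but it may fail to be onto.\<close>

locale complete_flow = C1_field +
  fixes X :: "real \<Rightarrow> real \<Rightarrow> real"
  assumes flow_ode: "\<And>T x. ode_solution c T (\<lambda>t. X t x)"
    and flow_0 [simp]: "\<And>x. X 0 x = x"
begin

lemma flow_unique:
  assumes "ode_solution c T y" "t \<in> {0..T}"
  shows "y t = X t (y 0)"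
  using ode_solution_diff[OF assms(1) flow_ode assms(2), of "y 0"] by simp

lemma flow_characteristic:
  assumes "characteristic c T \<gamma>" "t \<in> {0..T}"
  shows "X t (\<gamma> t) = \<gamma> 0"
  using flow_unique[OF ode_solution_reverse_characteristic[OF characteristic_subinterval[OF assms(1)]],
      of t t] assms(2) by simp

text \<open>Every characteristic arriving at \<open>(t, x)\<close> has foot \<open>X t x\<close>,
  and the reversed trajectory shows that there is one. Lying off the singular set thus becomes a
  condition on the point at which the datum is evaluated.\<close>

lemma mem_singular_set_iff: "(t, x) \<in> singular_set c D \<longleftrightarrow> 0 \<le> t \<and> X t x \<in> D"
proof
  assume "(t, x) \<in> singular_set c D"
  then obtain \<gamma> where "x = \<gamma> t" "0 \<le> t" "characteristic c t \<gamma>" "\<gamma> 0 \<in> D"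
    by (auto simp: singular_set_def)
  with flow_characteristic[of t \<gamma> t] show "0 \<le> t \<and> X t x \<in> D"
    by simp
next
  assume *: "0 \<le> t \<and> X t x \<in> D"
  have "characteristic c t (\<lambda>s. X (t - s) x)"
    by (rule characteristic_reverse_ode_solution[OF flow_ode])
  with * show "(t, x) \<in> singular_set c D"
    unfolding singular_set_def by (auto intro!: exI[of _ "\<lambda>s. X (t - s) x"])
qed

lemma flow_diff:
  "0 \<le> t \<Longrightarrow> X t y - X t x = (y - x) * exp (integral {0..t} (\<lambda>s. slope (X s x) (X s y)))"
  using ode_solution_diff[OF flow_ode flow_ode, of t t y x] by simp

lemma flow_mono:
  assumes "0 \<le> t" "x \<le> y"
  shows "X t x \<le> X t y"
  using flow_diff[OF assms(1), of y x] assms(2)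
  by (metis diff_ge_0_iff_ge exp_ge_zero mult_nonneg_nonneg)

lemma flow_has_derivative_time:
  assumes "0 \<le> t"
  shows "((\<lambda>t. X t x) has_real_derivative c (X t x)) (at t within {0..})"
proof -
  \<comment> \<open>The horizon \<open>t + 1\<close> lies strictly beyond \<open>t\<close>, so
    restricting to \<open>{0..t+1}\<close> or to \<open>{0..}\<close> makes no difference near
    \<open>t\<close>.\<close>
  have "((\<lambda>t. X t x) has_real_derivative c (X t x)) (at t within {0..t+1})"
    using ode_solutionD[OF flow_ode, of t "t + 1" x] assms by simp
  moreover have "at t within {0..t+1} = at t within {0..}"
    by (rule at_within_nhd[of _ "{..<t+1}"]) auto
  ultimately show ?thesis by simp
qed

lemma continuous_on_flow_time: "continuous_on {0..} (\<lambda>t. X t x)"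
  unfolding continuous_on_eq_continuous_within
  by (auto intro: DERIV_continuous flow_has_derivative_time)

text \<open>By monotonicity the trajectories from \<open>x - 1\<close> and \<open>x + 1\<close>
  enclose all those starting in between, so they stay in a compact interval up to time
  \<open>T\<close>. There \<open>slope\<close> is bounded, which bounds the exponential in
  \<open>flow_diff\<close> uniformly in time.\<close>

lemma flow_locally_lipschitz:
  obtains K where "\<And>t y. t \<in> {0..T} \<Longrightarrow> \<bar>y - x\<bar> \<le> 1 \<Longrightarrow> \<bar>X t y - X t x\<bar> \<le> K * \<bar>y - x\<bar>"
proof -
  have bounded: "\<exists>M. \<forall>t\<in>{0..T}. \<bar>X t y\<bar> \<le> M" for y
    using compact_imp_bounded[OF compact_continuous_image[OF
        continuous_on_subset[OF continuous_on_flow_time, of "{0..T}" y] compact_Icc]]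
    by (auto simp: bounded_iff)
  obtain M1 M2 where M: "\<And>t. t \<in> {0..T} \<Longrightarrow> \<bar>X t (x - 1)\<bar> \<le> M1"
      "\<And>t. t \<in> {0..T} \<Longrightarrow> \<bar>X t (x + 1)\<bar> \<le> M2"
    using bounded by meson
  define M where "M = max M1 M2"
  have "compact ((\<lambda>p. slope (fst p) (snd p)) ` ({-M..M} \<times> {-M..M}))"
    by (intro compact_continuous_image continuous_on_slope continuous_intros compact_Times compact_Icc)
  then obtain L where L: "\<And>a b. a \<in> {-M..M} \<Longrightarrow> b \<in> {-M..M} \<Longrightarrow> \<bar>slope a b\<bar> \<le> L"
    using compact_imp_bounded by (force simp: bounded_iff)
  show ?thesis
  proof
    fix t y :: real assume t: "t \<in> {0..T}" and y: "\<bar>y - x\<bar> \<le> 1"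
    have X: "X s z \<in> {-M..M}" if "s \<in> {0..T}" "\<bar>z - x\<bar> \<le> 1" for s z
    proof -
      have "X s (x - 1) \<le> X s z" "X s z \<le> X s (x + 1)"
        using that by (auto intro!: flow_mono)
      with M[OF that(1)] show ?thesis
        unfolding M_def atLeastAtMost_iff by linarith
    qed
    have "continuous_on {0..t} (\<lambda>s. slope (X s x) (X s y))"
      by (intro continuous_on_slope continuous_on_subset[OF continuous_on_flow_time]) auto
    then have int: "(\<lambda>s. slope (X s x) (X s y)) integrable_on {0..t}"
      by (rule integrable_continuous_real)
    have "integral {0..t} (\<lambda>s. slope (X s x) (X s y)) \<le> integral {0..t} (\<lambda>s. \<bar>L\<bar>)"
    proof (rule integral_le[OF int])
      fix s assume "s \<in> {0..t}"
      with t have "s \<in> {0..T}" by auto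
      from L[OF X[OF this] X[OF this y], of x] show "slope (X s x) (X s y) \<le> \<bar>L\<bar>"
        by simp
    qed (rule integrable_const_ivl)
    also have "\<dots> = t * \<bar>L\<bar>"
      using t by simp
    also have "\<dots> \<le> T * \<bar>L\<bar>"
      using t by (intro mult_right_mono) auto
    finally have "exp (integral {0..t} (\<lambda>s. slope (X s x) (X s y))) \<le> exp (T * \<bar>L\<bar>)"
      by simp
    with t show "\<bar>X t y - X t x\<bar> \<le> exp (T * \<bar>L\<bar>) * \<bar>y - x\<bar>"
      by (simp add: flow_diff abs_mult mult.commute[of _ "\<bar>y - x\<bar>"] mult_left_mono)
  qed
qed

text \<open>The increment is split at \<open>X s x\<close>: the spatial part is controlled by the
  Lipschitz bound, uniform in \<open>s \<le> t + 1\<close>, and the temporal part by continuity of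
  the single trajectory from \<open>x\<close>.\<close>

lemma continuous_on_flow: "continuous_on ({0..} \<times> UNIV) (\<lambda>p. X (fst p) (snd p))"
  unfolding continuous_on_eq_continuous_within
proof safe
  fix t x :: real assume t: "0 \<le> t"
  let ?F = "at (t, x) within {0..} \<times> UNIV"
  have lim: "(fst \<longlongrightarrow> t) ?F" "(snd \<longlongrightarrow> x) ?F"
    by (auto intro!: tendsto_eq_intros)
  have nonneg: "\<forall>\<^sub>F p in ?F. fst p \<in> {0..}"
    unfolding eventually_at_topological by (intro exI[of _ UNIV]) auto
  obtain K where K: "\<And>s y. s \<in> {0..t+1} \<Longrightarrow> \<bar>y - x\<bar> \<le> 1 \<Longrightarrow> \<bar>X s y - X s x\<bar> \<le> K * \<bar>y - x\<bar>"
    using flow_locally_lipschitz[of "t + 1" x] by blast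
  have "((\<lambda>p. X (fst p) (snd p) - X (fst p) x) \<longlongrightarrow> 0) ?F"
  proof (rule Lim_null_comparison)
    have "\<forall>\<^sub>F p in ?F. fst p < t + 1" "\<forall>\<^sub>F p in ?F. snd p < x + 1" "\<forall>\<^sub>F p in ?F. snd p > x - 1"
      using order_tendstoD[OF lim(1)] order_tendstoD[OF lim(2)] by auto
    with nonneg show "\<forall>\<^sub>F p in ?F. norm (X (fst p) (snd p) - X (fst p) x) \<le> K * \<bar>snd p - x\<bar>"
      by eventually_elim (auto intro!: K)
    show "((\<lambda>p. K * \<bar>snd p - x\<bar>) \<longlongrightarrow> 0) ?F"
      by (auto intro!: tendsto_eq_intros)
  qed
  moreover have "((\<lambda>p. X (fst p) x) \<longlongrightarrow> X t x) ?F"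
    using t nonneg by (intro continuous_on_tendsto_compose[OF continuous_on_flow_time lim(1)]) auto
  ultimately have "((\<lambda>p. X (fst p) (snd p)) \<longlongrightarrow> X t x) ?F"
    using tendsto_add by fastforce
  then show "continuous ?F (\<lambda>p. X (fst p) (snd p))"
    by (simp add: continuous_within)
qed

text \<open>The difference quotient of \<open>X t\<close> between \<open>x\<close> and
  \<open>y\<close>, given by the formula of \<open>flow_diff\<close> so that it also makes sense on
  the diagonal, where it is the spatial derivative.\<close>

definition spread :: "real \<Rightarrow> real \<Rightarrow> real \<Rightarrow> real" where
  "spread t x y = exp (integral {0..t} (\<lambda>s. slope (X s x) (X s y)))"

text \<open>Over the fixed interval \<open>{0..1}\<close>, joint continuity in \<open>t\<close>, \<open>x\<close>, \<open>y\<close> is continuity of an integral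
  in its parameters.\<close>

lemma spread_eq:
  assumes "0 \<le> t"
  shows "spread t x y = exp (t * integral {0..1} (\<lambda>\<theta>. slope (X (t * \<theta>) x) (X (t * \<theta>) y)))"
proof -
  let ?g = "\<lambda>s. slope (X s x) (X s y)"
  have "continuous_on {0..t} ?g"
    by (intro continuous_on_slope continuous_on_subset[OF continuous_on_flow_time]) auto
  moreover have "(*) t ` {0..1} \<subseteq> {0..t}"
    using assms by (auto simp: mult_left_le)
  ultimately
  have "((\<lambda>\<theta>. t * ?g (t * \<theta>)) has_integral integral {0..t} ?g) {0..1}"
    using has_integral_substitution[OF zero_le_one, of "\<lambda>\<theta>. t * \<theta>" 0 t ?g "\<lambda>_. t"] assms
    by (auto intro!: derivative_eq_intros)
  then have "integral {0..1} (\<lambda>\<theta>. t * ?g (t * \<theta>)) = integral {0..t} ?g"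
    by (rule integral_unique)
  then show ?thesis
    by (simp add: spread_def)
qed

lemma continuous_on_spread:
  "continuous_on ({0..} \<times> UNIV) (\<lambda>p. spread (fst p) (fst (snd p)) (snd (snd p)))"
proof -
  have "continuous_on ({0..} \<times> UNIV) (\<lambda>p. exp (fst p * integral (cbox 0 1)
      (\<lambda>\<theta>. slope (X (fst p * \<theta>) (fst (snd p))) (X (fst p * \<theta>) (snd (snd p))))))"
    by (intro continuous_intros integral_continuous_on_param)
      (auto simp: case_prod_unfold
        intro!: continuous_on_slope continuous_on_compose2[OF continuous_on_flow, of _ "\<lambda>p. (f p, g p)" for f g, simplified]
          continuous_intros)
  then show ?thesis
    by (rule continuous_on_eq) (auto simp: spread_eq)
qed

text \<open>Caratheodory's criterion: \<open>spread t x\<close> is a continuous factor of the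
  increment, so its value at \<open>x\<close> is the derivative.\<close>

lemma flow_has_derivative_space:
  assumes "0 \<le> t"
  shows "((\<lambda>x. X t x) has_real_derivative spread t x x) (at x)"
  unfolding CARAT_DERIV
proof (intro exI conjI allI)
  show "X t y - X t x = spread t x y * (y - x)" for y
    using flow_diff[OF assms] by (simp add: spread_def)
  have "continuous_on UNIV (spread t x)"
    using assms continuous_on_compose2[OF continuous_on_spread, of UNIV "\<lambda>y. (t, x, y)"]
    by (force intro!: continuous_intros)
  then show "isCont (spread t x) x"
    by (simp add: continuous_on_eq_continuous_at)
qed simp

text \<open>Along the trajectory from \<open>x\<close> the speed \<open>c (X s x)\<close> satisfies
  the linearised equation with coefficient \<open>c' (X s x)\<close>, whose fundamental solution is
  \<open>spread s x x\<close>. This identity turns the time derivative \<open>c (X t x)\<close> into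
  \<open>c x\<close> times the space derivative.\<close>

lemma field_flow_eq:
  assumes "0 \<le> t"
  shows "c (X t x) = c x * spread t x x"
proof -
  have "c (X t x) = c (X 0 x) * exp (integral {0..t} (\<lambda>s. c' (X s x)))"
  proof (rule linear_ode_solution)
    fix s assume s: "s \<in> {0..t}"
    show "((\<lambda>s. c (X s x)) has_real_derivative c' (X s x) * c (X s x)) (at s within {0..t})"
      by (rule DERIV_chain2[OF deriv ode_solutionD[OF flow_ode s]])
  qed (use assms in \<open>auto intro!: continuous_on_compose2[OF cont_deriv] continuous_on_subset[OF continuous_on_flow_time]\<close>)
  then show ?thesis
    by (simp add: spread_def)
qed

section \<open>Transport of piecewise smooth data by the flow\<close>

text \<open>The breakpoints \<open>D\<close> of \<open>g\<close> serve as breakpoints of the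
  solution: off the singular set the foot avoids \<open>D\<close>, and the chain rule
  applies.\<close>

lemma transport_solution_flow:
  assumes "piecewise_C1 g"
  shows "transport_solution c g (\<lambda>t x. g (X t x))"
proof -
  obtain D g' where D: "locally_finite_set D"
    and g: "\<And>x. x \<notin> D \<Longrightarrow> (g has_real_derivative g' x) (at x)" and g': "continuous_on (- D) g'"
    using assms unfolding piecewise_C1_def C1_differentiable_on_def
    by (auto simp: has_real_derivative_iff_has_vector_derivative Compl_eq_Diff_UNIV)
  let ?S = "{0..} \<times> UNIV - singular_set c D"
  have S: "(t, x) \<in> ?S \<longleftrightarrow> 0 \<le> t \<and> X t x \<notin> D" for t x
    by (auto simp: mem_singular_set_iff)
  have X: "continuous_on ?S (\<lambda>p. X (fst p) (snd p))"
    by (rule continuous_on_subset[OF continuous_on_flow]) auto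
  have g'X: "continuous_on ?S (\<lambda>p. g' (X (fst p) (snd p)))"
    by (rule continuous_on_compose2[OF g' X]) (auto simp: mem_singular_set_iff)
  have cX: "continuous_on ?S (\<lambda>p. c (X (fst p) (snd p)))"
    by (rule continuous_on_compose2[OF continuous_on_field X]) auto
  have "continuous_on ?S (\<lambda>p. (fst p, snd p, snd p))"
    by (intro continuous_intros)
  from continuous_on_compose2[OF continuous_on_spread this]
  have spread: "continuous_on ?S (\<lambda>p. spread (fst p) (snd p) (snd p))"
    by force
  have "classical_transport_on c ?S (\<lambda>t x. g (X t x))"
    unfolding classical_transport_on_def
  proof (intro exI conjI ballI)
    show "continuous_on ?S (\<lambda>(t, x). g' (X t x) * c (X t x))"
      "continuous_on ?S (\<lambda>(t, x). g' (X t x) * spread t x x)"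
      unfolding case_prod_unfold by (intro continuous_on_mult g'X cX spread)+
    fix p assume "p \<in> ?S"
    then obtain t x where p: "p = (t, x)" and t: "0 \<le> t" and x: "X t x \<notin> D"
      using S by (cases p) auto
    show "case p of (t, x) \<Rightarrow>
        ((\<lambda>s. g (X s x)) has_real_derivative g' (X t x) * c (X t x)) (at t within {0..}) \<and>
        ((\<lambda>y. g (X t y)) has_real_derivative g' (X t x) * spread t x x) (at x) \<and>
        g' (X t x) * c (X t x) = c x * (g' (X t x) * spread t x x)"
      using DERIV_chain2[OF g[OF x] flow_has_derivative_time[OF t]]
        DERIV_chain2[OF g[OF x] flow_has_derivative_space[OF t]]
      by (simp add: p field_flow_eq[OF t])
  qed
  \<comment> \<open>\<open>X s (\<gamma> s)\<close> is the foot \<open>\<gamma> 0\<close> at all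
    times, so the solution is constant along the curve even when that foot is a breakpoint.\<close>
  moreover have "((\<lambda>s. g (X s (\<gamma> s))) has_real_derivative 0) (at s within {0..T})"
    if "characteristic c T \<gamma>" "s \<in> {0..T}" for T \<gamma> s
  proof (rule has_field_derivative_transform_within[OF _ zero_less_one that(2)])
    show "((\<lambda>_. g (\<gamma> 0)) has_real_derivative 0) (at s within {0..T})"
      by simp
  qed (simp add: flow_characteristic[OF that(1)])
  ultimately show ?thesis
    using D unfolding transport_solution_def by auto
qed

text \<open>At time 0 the singular set reduces to \<open>D\<close>. This extracts the regularity of
  the datum from the existence of a solution, so that \<open>transport_solution_flow\<close> applies
  to each sample.\<close>

lemma piecewise_C1_initial_datum:
  assumes "transport_solution c g v"
  shows "piecewise_C1 g"
proof -
  obtain D vx where v0: "\<And>x. v 0 x = g x" and D: "locally_finite_set D"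
    and vx: "continuous_on ({0..} \<times> UNIV - singular_set c D) (\<lambda>(t, x). vx t x)"
    and d: "\<And>t x. (t, x) \<in> {0..} \<times> UNIV - singular_set c D \<Longrightarrow>
        ((\<lambda>y. v t y) has_real_derivative vx t x) (at x)"
    using assms unfolding transport_solution_def classical_transport_on_def
    by (fastforce simp del: Diff_iff)
  have S: "(0, x) \<in> {0..} \<times> UNIV - singular_set c D \<longleftrightarrow> x \<notin> D" for x
    by (auto simp: mem_singular_set_iff)
  have "continuous_on (UNIV - D) (\<lambda>x. vx 0 x)"
    using continuous_on_compose2[OF vx, of "UNIV - D" "\<lambda>x. (0, x)"] S
    by (force intro!: continuous_intros)
  moreover have "(g has_vector_derivative vx 0 x) (at x)" if "x \<in> UNIV - D" for x
    using d[of 0 x] that S v0 by (simp add: has_real_derivative_iff_has_vector_derivative)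
  ultimately show ?thesis
    using D unfolding piecewise_C1_def C1_differentiable_on_def by blast
qed

end

section \<open>Travel times: antiderivatives of the reciprocal speed\<close>

text \<open>Since \<open>c\<close> is Lipschitz, the integral of \<open>1 / c\<close> diverges logarithmically at a zero of \<open>c\<close>.\<close>

lemma (in C1_field) quadrature_unbounded:
  assumes "a < b" and pos: "\<And>y. a \<le> y \<Longrightarrow> y < b \<Longrightarrow> 0 < c y" and "c b \<le> 0"
    and F: "\<And>y. a \<le> y \<Longrightarrow> y < b \<Longrightarrow> (F has_real_derivative 1 / c y) (at y)"
  shows "\<exists>y\<ge>a. y < b \<and> M < F y"
proof -
  have "compact ((\<lambda>y. slope y b) ` {a..b})"
    by (intro compact_continuous_image continuous_on_slope continuous_intros compact_Icc)
  then obtain L0 where L0: "\<And>y. y \<in> {a..b} \<Longrightarrow> \<bar>slope y b\<bar> \<le> L0"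
    using compact_imp_bounded by (force simp: bounded_iff)
  define L where "L = max L0 1"
  have "0 < L" by (simp add: L_def)
  have upper: "c y \<le> L * (b - y)" if "a \<le> y" "y < b" for y
  proof -
    have "- slope y b \<le> L"
      using L0[of y] that unfolding L_def by auto
    then have "- slope y b * (b - y) \<le> L * (b - y)"
      using that by (intro mult_right_mono) auto
    with slope_mult[of y b] \<open>c b \<le> 0\<close> show ?thesis
      by linarith
  qed
  \<comment> \<open>\<open>F a + K\<close> exceeds \<open>M\<close>, and \<open>y\<close> is placed
    so that \<open>ln (b - y)\<close> falls short of \<open>ln (b - a)\<close> by exactly
    \<open>L * K\<close>.\<close>
  define K where "K = \<bar>M - F a\<bar> + 1"
  define y where "y = b - (b - a) * exp (- L * K)"
  have "0 < K" by (simp add: K_def)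
  with \<open>0 < L\<close> have "exp (- L * K) \<le> 1" by simp
  with \<open>a < b\<close> have "(b - a) * exp (- L * K) \<le> (b - a) * 1"
    by (intro mult_left_mono) auto
  then have "a \<le> y"
    unfolding y_def mult_1_right by linarith
  moreover have "y < b"
    using \<open>a < b\<close> by (simp add: y_def)
  ultimately have y: "a \<le> y" "y < b" .
  \<comment> \<open>Since \<open>c z\<close> is at most \<open>L * (b - z)\<close>, the function
    \<open>F\<close> grows at least as fast as \<open>- ln (b - z) / L\<close>.\<close>
  have "F a + ln (b - a) / L \<le> F y + ln (b - y) / L"
  proof (rule DERIV_nonneg_imp_nondecreasing[OF y(1)])
    fix z assume z: "a \<le> z" "z \<le> y"
    with y have z': "z < b" by simp
    have "((\<lambda>z. F z + ln (b - z) / L) has_real_derivative 1 / c z - 1 / (L * (b - z))) (at z)"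
      using z' z \<open>0 < L\<close> pos[OF z(1) z']
      by (auto intro!: derivative_eq_intros DERIV_cong[OF F] simp: field_simps)
    moreover have "1 / (L * (b - z)) \<le> 1 / c z"
      using upper[OF z(1) z'] pos[OF z(1) z'] by (intro divide_left_mono mult_pos_pos) (use \<open>0 < L\<close> z' in auto)
    ultimately show "\<exists>d. ((\<lambda>z. F z + ln (b - z) / L) has_real_derivative d) (at z) \<and> 0 \<le> d"
      by auto
  qed
  moreover have "ln (b - y) = ln (b - a) - L * K"
    using \<open>a < b\<close> by (simp add: y_def ln_mult)
  ultimately have "F a + K \<le> F y"
    using \<open>0 < L\<close> by (simp add: diff_divide_distrib)
  then have "M < F y"
    unfolding K_def by linarith
  with y show ?thesis by blast
qed

text \<open>Reflection of the previous lemma. The reflected function is \<open>c (- y)\<close>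
  without a sign change, so that it stays positive; \<open>- F (- y)\<close> is an antiderivative of
  its reciprocal.\<close>

lemma (in C1_field) quadrature_unbounded_below:
  assumes "a < b" and pos: "\<And>y. a < y \<Longrightarrow> y \<le> b \<Longrightarrow> 0 < c y" and "c a \<le> 0"
    and F: "\<And>y. a < y \<Longrightarrow> y \<le> b \<Longrightarrow> (F has_real_derivative 1 / c y) (at y)"
  shows "\<exists>y>a. y \<le> b \<and> F y < M"
proof -
  interpret reflected: C1_field "\<lambda>y. c (- y)" "\<lambda>y. - c' (- y)"
  proof
    show "((\<lambda>y. c (- y)) has_real_derivative - c' (- y)) (at y)" for y
      using DERIV_chain2[OF deriv DERIV_minus[OF DERIV_ident], of y UNIV] by simp
    show "continuous_on UNIV (\<lambda>y. - c' (- y))"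
      by (intro continuous_intros continuous_on_compose2[OF cont_deriv]) auto
  qed
  have "\<exists>y\<ge>-b. y < -a \<and> - M < - F (- y)"
  proof (rule reflected.quadrature_unbounded)
    show "((\<lambda>y. - F (- y)) has_real_derivative 1 / c (- y)) (at y)" if "- b \<le> y" "y < - a" for y
      using that by (auto intro!: derivative_eq_intros DERIV_chain2[OF F])
  qed (use assms in auto)
  then obtain y where "-b \<le> y" "y < -a" "- M < - F (- y)" by blast
  then show ?thesis
    by (intro exI[of _ "- y"]) auto
qed

text \<open>\<open>J\<close> is the maximal interval around \<open>x\<close> on which
  \<open>c\<close> is positive, and differences of \<open>F\<close> are travel times. A point
  outside \<open>J\<close> forces a finite endpoint on its side; there \<open>c\<close> is not
  positive, so the travel time to it diverges.\<close>

lemma (in C1_field) quadrature: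
  assumes "0 < c x"
  obtains J F where "open J" "connected J" "x \<in> J"
    and "\<And>y. y \<in> J \<Longrightarrow> 0 < c y"
    and "\<And>y. y \<in> J \<Longrightarrow> (F has_real_derivative 1 / c y) (at y)"
    and "\<And>z M. x < z \<Longrightarrow> z \<notin> J \<Longrightarrow> \<exists>y\<in>J. M < F y"
    and "\<And>z M. z < x \<Longrightarrow> z \<notin> J \<Longrightarrow> \<exists>y\<in>J. F y < M"
proof -
  \<comment> \<open>The nearest obstacles to positivity on either side of \<open>x\<close>. In the
    extended reals, \<open>Sup\<close> and \<open>Inf\<close> of the empty set give the infinite
    endpoints.\<close>
  define a where "a = Sup (ereal ` {z. z < x \<and> c z \<le> 0})"
  define b where "b = Inf (ereal ` {z. x < z \<and> c z \<le> 0})"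
  \<comment> \<open>Used at \<open>x\<close> to separate it from both endpoints, and at a finite
    endpoint to refute positivity there: the supremum or infimum could be moved further away from
    \<open>x\<close>.\<close>
  have nbhd: "\<exists>d>0. \<forall>y. c y \<le> 0 \<longrightarrow> d \<le> \<bar>y - z\<bar>" if "0 < c z" for z
  proof -
    have "isCont c z" by (rule DERIV_isCont[OF deriv])
    then have "\<forall>\<^sub>F y in nhds z. 0 < c y"
      using that by (metis isCont_def order_tendstoD(1) tendsto_compose_eventually tendsto_at_iff_tendsto_nhds)
    then show ?thesis
      by (auto simp: eventually_nhds_metric dist_real_def) (meson not_less)
  qed
  obtain d where d: "0 < d" "\<And>y. c y \<le> 0 \<Longrightarrow> d \<le> \<bar>y - x\<bar>"
    using nbhd[OF assms] by blast
  have "a \<le> ereal (x - d)"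
    unfolding a_def by (intro SUP_least) (use d in force)
  also have "\<dots> < ereal x"
    using d by simp
  finally have ax: "a < ereal x" .
  have "ereal x < ereal (x + d)"
    using d by simp
  also have "\<dots> \<le> b"
    unfolding b_def by (intro INF_greatest) (use d in force)
  finally have xb: "ereal x < b" .
  have pos: "0 < c y" if "y \<in> einterval a b" for y
  proof (rule ccontr)
    assume "\<not> 0 < c y"
    with assms consider "y < x" "c y \<le> 0" | "x < y" "c y \<le> 0"
      by (cases y x rule: linorder_cases) auto
    then show False
    proof cases
      case 1
      then have "ereal y \<le> a" unfolding a_def by (intro SUP_upper) auto
      with that show False by (auto simp: einterval_iff dest: leD)
    next
      case 2
      then have "b \<le> ereal y" unfolding b_def by (intro INF_lower) auto
      with that show False by (auto simp: einterval_iff dest: leD)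
    qed
  qed
  have "isCont (\<lambda>y. 1 / c y) y" if "a < ereal y" "ereal y < b" for y
    using pos[of y] that DERIV_isCont[OF deriv, of y]
    by (intro continuous_intros) (auto simp: einterval_iff)
  with einterval_antiderivative[of a b "\<lambda>y. 1 / c y"] less_trans[OF ax xb]
  obtain F where F: "\<And>y. y \<in> einterval a b \<Longrightarrow> (F has_real_derivative 1 / c y) (at y)"
    by (auto simp: einterval_iff has_real_derivative_iff_has_vector_derivative)
  show ?thesis
  proof
    show "connected (einterval a b)"
      using ax xb by (cases a; cases b) auto
    show "\<exists>y\<in>einterval a b. M < F y" if "x < z" "z \<notin> einterval a b" for z M
    proof -
      have "b \<le> ereal z"
        using that less_trans[OF ax, of "ereal z"] by (simp add: einterval_iff not_less)
      with xb obtain \<beta> where \<beta>: "b = ereal \<beta>"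
        by (cases b) auto
      have "c \<beta> \<le> 0"
      proof (rule ccontr)
        assume "\<not> c \<beta> \<le> 0"
        then obtain e where e: "0 < e" "\<And>y. c y \<le> 0 \<Longrightarrow> e \<le> \<bar>y - \<beta>\<bar>"
          using nbhd[of \<beta>] by auto
        have "ereal (\<beta> + e) \<le> b"
          unfolding b_def
        proof (intro INF_greatest)
          fix y assume y: "y \<in> {z. x < z \<and> c z \<le> 0}"
          then have "b \<le> ereal y" unfolding b_def by (intro INF_lower)
          with y e(2)[of y] show "ereal (\<beta> + e) \<le> ereal y"
            by (force simp: \<beta>)
        qed
        with e show False by (simp add: \<beta>)
      qed
      have in_J: "y \<in> einterval a b" if "x \<le> y" "y < \<beta>" for y
        using that order_less_le_trans[OF ax, of "ereal y"] by (simp add: einterval_iff \<beta>)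
      have "\<exists>y\<ge>x. y < \<beta> \<and> M < F y"
        using xb in_J pos F \<open>c \<beta> \<le> 0\<close> by (intro quadrature_unbounded) (auto simp: \<beta>)
      with in_J show ?thesis by blast
    qed
    show "\<exists>y\<in>einterval a b. F y < M" if "z < x" "z \<notin> einterval a b" for z M
    proof -
      have "ereal z \<le> a"
        using that less_trans[OF _ xb, of "ereal z"] by (simp add: einterval_iff not_less)
      with ax obtain \<alpha> where \<alpha>: "a = ereal \<alpha>"
        by (cases a) auto
      have "c \<alpha> \<le> 0"
      proof (rule ccontr)
        assume "\<not> c \<alpha> \<le> 0"
        then obtain e where e: "0 < e" "\<And>y. c y \<le> 0 \<Longrightarrow> e \<le> \<bar>y - \<alpha>\<bar>"
          using nbhd[of \<alpha>] by auto
        have "a \<le> ereal (\<alpha> - e)"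
          unfolding a_def
        proof (intro SUP_least)
          fix y assume y: "y \<in> {z. z < x \<and> c z \<le> 0}"
          then have "ereal y \<le> a" unfolding a_def by (intro SUP_upper)
          with y e(2)[of y] show "ereal y \<le> ereal (\<alpha> - e)"
            by (force simp: \<alpha>)
        qed
        with e show False by (simp add: \<alpha>)
      qed
      have in_J: "y \<in> einterval a b" if "\<alpha> < y" "y \<le> x" for y
        using that order_le_less_trans[OF _ xb, of "ereal y"] by (simp add: einterval_iff \<alpha>)
      have "\<exists>y>\<alpha>. y \<le> x \<and> F y < M"
        using ax in_J pos F \<open>c \<alpha> \<le> 0\<close> by (intro quadrature_unbounded_below) (auto simp: \<alpha>)
      with in_J show ?thesis by blast
    qed
  qed (use ax xb pos F in \<open>auto simp: einterval_iff\<close>)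
qed

section \<open>Superposition and reflection of classical solutions\<close>

text \<open>Continuity of the space derivative upgrades the partial derivatives to a total
  derivative on the half-plane. Along a characteristic the chain rule gives
  \<open>wt - c * wx\<close>, which vanishes.\<close>

lemma classical_transport_on_characteristic:
  assumes w: "classical_transport_on c ({0..} \<times> UNIV) w" and \<gamma>: "characteristic c T \<gamma>" and s: "s \<in> {0..T}"
  shows "((\<lambda>s. w s (\<gamma> s)) has_real_derivative 0) (at s within {0..T})"
proof -
  obtain wt wx where wx: "continuous_on ({0..} \<times> UNIV) (\<lambda>(t, x). wx t x)"
    and dt: "\<And>t x. 0 \<le> t \<Longrightarrow> ((\<lambda>t. w t x) has_real_derivative wt t x) (at t within {0..})"
    and dx: "\<And>t x. 0 \<le> t \<Longrightarrow> ((\<lambda>x. w t x) has_real_derivative wx t x) (at x)"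
    and eq: "\<And>t x. 0 \<le> t \<Longrightarrow> wt t x = c x * wx t x"
    using w unfolding classical_transport_on_def by fastforce
  have "((\<lambda>(t, x). w t x) has_derivative
      (\<lambda>(h, k). wt s (\<gamma> s) * h + blinfun_apply (blinfun_mult_right (wx s (\<gamma> s))) k))
      (at (s, \<gamma> s) within {0..} \<times> UNIV)"
  proof (rule has_derivative_partialsI)
    show "((\<lambda>t. w t (\<gamma> s)) has_derivative (*) (wt s (\<gamma> s))) (at s within {0..})"
      using dt[of s "\<gamma> s"] s by (simp add: has_field_derivative_def)
    show "((\<lambda>x. w t x) has_derivative blinfun_apply (blinfun_mult_right (wx t x))) (at x within UNIV)"
      if "t \<in> {0..}" for t x
      using dx[of t x] that by (simp add: has_field_derivative_def blinfun_mult_right.rep_eq)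
    have "continuous_on ({0..} \<times> UNIV) (\<lambda>p. blinfun_mult_right (wx (fst p) (snd p)) :: real \<Rightarrow>\<^sub>L real)"
      using wx by (intro bounded_linear.continuous_on[OF bounded_linear_blinfun_mult_right])
        (simp add: case_prod_unfold)
    then show "continuous (at (s, \<gamma> s) within {0..} \<times> UNIV) (\<lambda>(t, x). blinfun_mult_right (wx t x))"
      using s by (simp add: continuous_on_eq_continuous_within case_prod_unfold)
  qed auto
  then have "((\<lambda>p. w (fst p) (snd p)) has_derivative
      (\<lambda>p. wt s (\<gamma> s) * fst p + wx s (\<gamma> s) * snd p)) (at (s, \<gamma> s) within {0..} \<times> UNIV)"
    by (simp add: case_prod_unfold)
  then have "((\<lambda>p. w (fst p) (snd p)) has_derivative
      (\<lambda>p. wt s (\<gamma> s) * fst p + wx s (\<gamma> s) * snd p)) (at (s, \<gamma> s) within (\<lambda>s. (s, \<gamma> s)) ` {0..T})"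
    by (rule has_derivative_subset) auto
  moreover have "((\<lambda>s. (s, \<gamma> s)) has_derivative (\<lambda>h. (h, - c (\<gamma> s) * h))) (at s within {0..T})"
    using \<gamma> s by (intro has_derivative_Pair has_derivative_ident has_field_derivative_imp_has_derivative)
      (auto simp: characteristic_def)
  ultimately have "((\<lambda>s. w s (\<gamma> s)) has_derivative
      (\<lambda>h. wt s (\<gamma> s) * h + wx s (\<gamma> s) * (- c (\<gamma> s) * h))) (at s within {0..T})"
    using has_derivative_in_compose[of "\<lambda>s. (s, \<gamma> s)" _ s "{0..T}"] by fastforce
  then show ?thesis
    using s by (simp add: has_field_derivative_def eq algebra_simps lambda_zero)
qed

text \<open>The breakpoints of \<open>v\<close> also serve for the sum, because \<open>w\<close> is
  constant along every characteristic. A nonzero \<open>w\<close> therefore contradicts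
  uniqueness.\<close>

lemma transport_solution_add_classical:
  assumes v: "transport_solution c g v"
    and w: "classical_transport_on c ({0..} \<times> UNIV) w" and w0: "\<And>x. w 0 x = 0"
  shows "transport_solution c g (\<lambda>t x. v t x + w t x)"
proof -
  obtain D where D: "locally_finite_set D"
    and cl: "classical_transport_on c ({0..} \<times> UNIV - singular_set c D) v"
    and ch: "\<And>T \<gamma> s. 0 \<le> T \<Longrightarrow> characteristic c T \<gamma> \<Longrightarrow> \<gamma> 0 \<in> D \<Longrightarrow> s \<in> {0..T} \<Longrightarrow>
        ((\<lambda>s. v s (\<gamma> s)) has_real_derivative 0) (at s within {0..T})"
    and v0: "\<And>x. v 0 x = g x"
    using v unfolding transport_solution_def by blast
  let ?S = "{0..} \<times> UNIV - singular_set c D"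
  obtain vt vx where v': "continuous_on ?S (\<lambda>(t, x). vt t x)" "continuous_on ?S (\<lambda>(t, x). vx t x)"
    "\<forall>(t, x)\<in>?S. ((\<lambda>s. v s x) has_real_derivative vt t x) (at t within {0..}) \<and>
      ((\<lambda>y. v t y) has_real_derivative vx t x) (at x) \<and> vt t x = c x * vx t x"
    using cl unfolding classical_transport_on_def by blast
  obtain wt wx where w': "continuous_on ({0..} \<times> UNIV) (\<lambda>(t, x). wt t x)"
    "continuous_on ({0..} \<times> UNIV) (\<lambda>(t, x). wx t x)"
    "\<forall>(t, x)\<in>{0..} \<times> UNIV. ((\<lambda>s. w s x) has_real_derivative wt t x) (at t within {0..}) \<and>
      ((\<lambda>y. w t y) has_real_derivative wx t x) (at x) \<and> wt t x = c x * wx t x"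
    using w unfolding classical_transport_on_def by blast
  have "classical_transport_on c ?S (\<lambda>t x. v t x + w t x)"
    unfolding classical_transport_on_def
  proof (intro exI conjI)
    have "continuous_on ?S (\<lambda>(t, x). wt t x)" "continuous_on ?S (\<lambda>(t, x). wx t x)"
      using w'(1,2) by (auto intro: continuous_on_subset)
    with v'(1,2) show "continuous_on ?S (\<lambda>(t, x). vt t x + wt t x)"
      "continuous_on ?S (\<lambda>(t, x). vx t x + wx t x)"
      by (auto simp: case_prod_unfold intro!: continuous_on_add)
    show "\<forall>(t, x)\<in>?S. ((\<lambda>s. v s x + w s x) has_real_derivative vt t x + wt t x) (at t within {0..}) \<and>
      ((\<lambda>y. v t y + w t y) has_real_derivative vx t x + wx t x) (at x) \<and>
      vt t x + wt t x = c x * (vx t x + wx t x)"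
      using v'(3) w'(3) by (fastforce intro!: DERIV_add simp: distrib_left)
  qed
  moreover have "((\<lambda>s. v s (\<gamma> s) + w s (\<gamma> s)) has_real_derivative 0) (at s within {0..T})"
    if "0 \<le> T" "characteristic c T \<gamma>" "\<gamma> 0 \<in> D" "s \<in> {0..T}" for T \<gamma> s
    using DERIV_add[OF ch[OF that] classical_transport_on_characteristic[OF w that(2,4)]] by simp
  ultimately show ?thesis
    using D v0 w0 unfolding transport_solution_def by auto
qed

text \<open>Reduces leftward motion to rightward motion.\<close>

lemma classical_transport_on_reflect:
  assumes "classical_transport_on (\<lambda>x. - c (- x)) ({0..} \<times> UNIV) w"
  shows "classical_transport_on c ({0..} \<times> UNIV) (\<lambda>t x. w t (- x))"
proof -
  obtain wt wx where w': "continuous_on ({0..} \<times> UNIV) (\<lambda>(t, x). wt t x)"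
    "continuous_on ({0..} \<times> UNIV) (\<lambda>(t, x). wx t x)"
    and d: "\<And>t x. 0 \<le> t \<Longrightarrow> ((\<lambda>s. w s x) has_real_derivative wt t x) (at t within {0..})"
      "\<And>t x. 0 \<le> t \<Longrightarrow> ((\<lambda>y. w t y) has_real_derivative wx t x) (at x)"
      "\<And>t x. 0 \<le> t \<Longrightarrow> wt t x = - c (- x) * wx t x"
    using assms unfolding classical_transport_on_def by fastforce
  have r: "continuous_on ({0..} \<times> UNIV) (\<lambda>p::real \<times> real. (fst p, - snd p))"
    by (intro continuous_intros)
  show ?thesis
    unfolding classical_transport_on_def
  proof (intro exI conjI)
    show "continuous_on ({0..} \<times> UNIV) (\<lambda>(t, x). wt t (- x))"
      "continuous_on ({0..} \<times> UNIV) (\<lambda>(t, x). - wx t (- x))"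
      using continuous_on_compose2[OF w'(1) r] continuous_on_compose2[OF w'(2) r]
      by (auto simp: case_prod_unfold image_subset_iff intro!: continuous_on_minus)
    show "\<forall>(t, x)\<in>{0..} \<times> UNIV.
        ((\<lambda>s. w s (- x)) has_real_derivative wt t (- x)) (at t within {0..}) \<and>
        ((\<lambda>y. w t (- y)) has_real_derivative - wx t (- x)) (at x) \<and>
        wt t (- x) = c x * - wx t (- x)"
    proof safe
      fix t x :: real assume t: "0 \<le> t"
      show "((\<lambda>s. w s (- x)) has_real_derivative wt t (- x)) (at t within {0..})"
        "wt t (- x) = c x * - wx t (- x)"
        using d(1)[OF t, of "- x"] d(3)[OF t, of "- x"] by simp_all
      show "((\<lambda>y. w t (- y)) has_real_derivative - wx t (- x)) (at x)"
        using DERIV_chain2[OF d(2)[OF t] DERIV_minus[OF DERIV_ident], of x UNIV] by simp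
    qed
  qed
qed

section \<open>Global trajectories or solutions entering from infinity\<close>

lemma strict_mono_on_antiderivative:
  fixes F :: "real \<Rightarrow> real"
  assumes "connected J" and "\<And>y. y \<in> J \<Longrightarrow> (F has_real_derivative f y) (at y)" and "\<And>y. y \<in> J \<Longrightarrow> 0 < f y"
    and "y \<in> J" "z \<in> J" "y < z"
  shows "F y < F z"
proof (rule DERIV_pos_imp_increasing[OF \<open>y < z\<close>])
  fix x assume "y \<le> x" "x \<le> z"
  with assms have "x \<in> J"
    using connected_contains_Icc[of J y z] by auto
  with assms show "\<exists>d. (F has_real_derivative d) (at x) \<and> 0 < d"
    by blast
qed

text \<open>Separation of variables: the trajectory is the inverse of \<open>F\<close> applied to
  \<open>F x + t\<close>. Unboundedness of \<open>F\<close> on the interval \<open>J\<close> puts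
  every such value with \<open>t \<ge> 0\<close> in its range.\<close>

lemma ode_solution_quadrature:
  assumes J: "open J" "connected J" "x \<in> J"
    and pos: "\<And>y. y \<in> J \<Longrightarrow> 0 < c y"
    and F: "\<And>y. y \<in> J \<Longrightarrow> (F has_real_derivative 1 / c y) (at y)"
    and unbounded: "\<And>M. \<exists>y\<in>J. M < F y"
  shows "\<exists>y. y 0 = x \<and> (\<forall>T. ode_solution c T y)"
proof -
  have mono: "F y < F z" if "y \<in> J" "z \<in> J" "y < z" for y z
    by (rule strict_mono_on_antiderivative[OF J(2) F _ that]) (auto intro: pos)
  have inj: "inj_on F J"
    by (rule linorder_inj_onI') (use mono in fastforce)
  have contF: "continuous_on J F"
    using F by (meson DERIV_isCont continuous_at_imp_continuous_on)
  have range: "F x + t \<in> F ` J" if "0 \<le> t" for t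
  proof -
    obtain y where y: "y \<in> J" "F x + t < F y"
      using unbounded by blast
    have "connected (F ` J)"
      by (rule connected_continuous_image[OF contF J(2)])
    with y J(3) that show ?thesis
      using connected_contains_Icc[of "F ` J" "F x" "F y"] by (auto simp: subset_iff)
  qed
  define G where "G = the_inv_into J F"
  have G: "G (F y) = y" if "y \<in> J" for y
    unfolding G_def by (rule the_inv_into_f_f[OF inj that])
  have dG: "(G has_real_derivative c y) (at (F y))" if y: "y \<in> J" for y
    unfolding has_field_derivative_def
  proof (rule has_derivative_inverse_strong[OF J(1) y contF G])
    show "(F has_derivative (*) (1 / c y)) (at y)"
      using F[OF y] by (simp add: has_field_derivative_def)
    show "(*) (1 / c y) \<circ> (*) (c y) = id"
      using pos[OF y] by (auto simp: fun_eq_iff)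
  qed
  have "((\<lambda>t. G (F x + t)) has_real_derivative c (G (F x + t))) (at t within A)" if t: "0 \<le> t" for t A
  proof -
    obtain y where y: "y \<in> J" "F x + t = F y"
      using range[OF t] by blast
    have "((\<lambda>t. F x + t) has_real_derivative 1) (at t within A)"
      by (auto intro!: derivative_eq_intros)
    from DERIV_chain2[OF _ this, of G "c y"] dG[OF y(1)] show ?thesis
      by (simp add: y G)
  qed
  then show ?thesis
    using G[OF J(3)] unfolding ode_solution_def by (intro exI[of _ "\<lambda>t. G (F x + t)"]) auto
qed

text \<open>The wave profile used below. Squaring makes the derivative continuous at 0, so that the
  wave joins the zero state in a continuously differentiable way.\<close>

lemma has_real_derivative_square_pos_part:
  "((\<lambda>s::real. (max 0 s)\<^sup>2) has_real_derivative 2 * max 0 s) (at s)"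
proof (cases s "0::real" rule: linorder_cases)
  case less
  have "((\<lambda>_. 0) has_real_derivative 2 * max 0 s) (at s)"
    using less by simp
  then show ?thesis
    by (rule has_field_derivative_transform_within_open[of _ _ _ "{..<0}"]) (use less in auto)
next
  case equal
  show ?thesis
    unfolding CARAT_DERIV equal by (intro exI[of _ "max 0"] conjI allI)
      (auto simp: power2_eq_square max_def intro!: continuous_intros)
next
  case greater
  have "((\<lambda>s. s\<^sup>2) has_real_derivative 2 * max 0 s) (at s)"
    using greater by (auto intro!: derivative_eq_intros)
  then show ?thesis
    by (rule has_field_derivative_transform_within_open[of _ _ _ "{0<..}"]) (use greater in auto)
qed

definition spontaneous_solution :: "(real \<Rightarrow> real) \<Rightarrow> (real \<Rightarrow> real \<Rightarrow> real) \<Rightarrow> bool" where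
  "spontaneous_solution c w \<longleftrightarrow> classical_transport_on c ({0..} \<times> UNIV) w \<and> (\<forall>x. w 0 x = 0) \<and>
     (\<exists>t\<ge>0. \<exists>x. w t x \<noteq> 0)"

text \<open>\<open>J\<close> contains everything to the right of \<open>x\<close>, and boundedness
  of \<open>F\<close> means that infinity is reached in finite time. A wave depending only on
  \<open>t + F y\<close> is sent in from there. Where \<open>J\<close> ends on the left,
  \<open>F\<close> tends to minus infinity, so the wave extends by zero.\<close>

lemma (in C1_field) spontaneous_solution_escape:
  assumes J: "open J" "connected J" "x \<in> J"
    and pos: "\<And>y. y \<in> J \<Longrightarrow> 0 < c y"
    and F: "\<And>y. y \<in> J \<Longrightarrow> (F has_real_derivative 1 / c y) (at y)"
    and up: "\<And>z. x < z \<Longrightarrow> z \<in> J"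
    and down: "\<And>z m. z < x \<Longrightarrow> z \<notin> J \<Longrightarrow> \<exists>y\<in>J. F y < m"
    and bounded: "\<And>y. y \<in> J \<Longrightarrow> F y \<le> M"
  shows "\<exists>w. spontaneous_solution c w"
proof -
  have mono: "F y < F z" if "y \<in> J" "z \<in> J" "y < z" for y z
    by (rule strict_mono_on_antiderivative[OF J(2) F _ that]) (auto intro: pos)
  \<comment> \<open>Near and to the left of a point outside \<open>J\<close>, the part lying in
    \<open>J\<close> has arbitrarily small \<open>F\<close>, which keeps the wave at zero
    there.\<close>
  have vanish: "\<exists>b>y. \<forall>z<b. z \<in> J \<longrightarrow> F z < m" if y: "y \<notin> J" for y m
  proof -
    have "y < x"
      using y up J(3) by (cases y x rule: linorder_cases) auto
    then obtain b where b: "b \<in> J" "F b < m"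
      using down[OF _ y] by blast
    have "y < b"
    proof (rule ccontr)
      assume "\<not> y < b"
      with \<open>y < x\<close> b J y show False
        using connected_contains_Icc[of J b x] by (auto simp: subset_iff)
    qed
    moreover have "F z < m" if "z < b" "z \<in> J" for z
      using mono[OF that(2) b(1) that(1)] b(2) by simp
    ultimately show ?thesis
      by blast
  qed
  \<comment> \<open>Common form of both partial derivatives, so that continuity is proved once:
    \<open>r\<close> is 2 for the time derivative and \<open>2 / c\<close> for the space
    derivative.\<close>
  define k where "k = (\<lambda>r t y. if y \<in> J then max 0 (t + F y - M) * r y else (0::real))"
  have cont_k: "continuous_on ({0..} \<times> UNIV) (\<lambda>(t, y). k r t y)" if r: "continuous_on J r" for r
  proof (intro continuous_at_imp_continuous_on ballI)
    fix p :: "real \<times> real"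
    obtain t y where p: "p = (t, y)" by (cases p)
    show "isCont (\<lambda>(t, y). k r t y) p"
    proof (cases "y \<in> J")
      case True
      have "continuous_on (UNIV \<times> J) (\<lambda>p. max 0 (fst p + F (snd p) - M) * r (snd p))"
        by (intro continuous_intros continuous_on_compose2[OF r]
            continuous_on_compose2[of J F, OF continuous_at_imp_continuous_on])
          (auto intro: DERIV_isCont F)
      then have "continuous_on (UNIV \<times> J) (\<lambda>(t, y). k r t y)"
        by (rule continuous_on_eq) (auto simp: k_def)
      moreover have "p \<in> interior (UNIV \<times> J)"
        using True J(1) by (simp add: p interior_open open_Times)
      ultimately show ?thesis
        by (rule continuous_on_interior)
    next
      case False
      \<comment> \<open>The margin 1 keeps \<open>s + F z - M\<close> negative for all times
        \<open>s < t + 1\<close>, so \<open>k r\<close> vanishes on a whole neighbourhood of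
        \<open>p\<close>.\<close>
      obtain b where b: "y < b" "\<And>z. z < b \<Longrightarrow> z \<in> J \<Longrightarrow> F z < M - (t + 1)"
        using vanish[OF False] by blast
      have "continuous_on ({..<t+1} \<times> {..<b}) (\<lambda>_. 0 :: real)"
        by simp
      then have "continuous_on ({..<t+1} \<times> {..<b}) (\<lambda>(t, y). k r t y)"
        by (rule continuous_on_eq) (use b in \<open>fastforce simp: k_def\<close>)
      moreover have "p \<in> interior ({..<t+1} \<times> {..<b})"
        using b(1) by (simp add: p interior_open open_Times)
      ultimately show ?thesis
        by (rule continuous_on_interior)
    qed
  qed
  \<comment> \<open>\<open>M - F y\<close> bounds the time the backward characteristic from \<open>y\<close> takes to reach infinity, so
    the level sets of \<open>t + F y\<close> are characteristics entering from infinity.\<close>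
  define w where "w = (\<lambda>t y. if y \<in> J then (max 0 (t + F y - M))\<^sup>2 else 0)"
  have "classical_transport_on c ({0..} \<times> UNIV) w"
    unfolding classical_transport_on_def
  proof (intro exI conjI)
    show "continuous_on ({0..} \<times> UNIV) (\<lambda>(t, y). k (\<lambda>_. 2) t y)"
      by (rule cont_k) simp
    have "\<And>y. y \<in> J \<Longrightarrow> c y \<noteq> 0"
      using pos by force
    then show "continuous_on ({0..} \<times> UNIV) (\<lambda>(t, y). k (\<lambda>y. 2 / c y) t y)"
      by (intro cont_k continuous_intros continuous_on_field) auto
    show "\<forall>(t, y)\<in>{0..} \<times> UNIV.
        ((\<lambda>s. w s y) has_real_derivative k (\<lambda>_. 2) t y) (at t within {0..}) \<and>
        ((\<lambda>z. w t z) has_real_derivative k (\<lambda>y. 2 / c y) t y) (at y) \<and>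
        k (\<lambda>_. 2) t y = c y * k (\<lambda>y. 2 / c y) t y"
    proof safe
      fix t y :: real assume "0 \<le> t"
      show "k (\<lambda>_. 2) t y = c y * k (\<lambda>y. 2 / c y) t y"
        using pos[of y] by (auto simp: k_def)
      have "((\<lambda>s. s + F y - M) has_real_derivative 1) (at t within {0..})"
        by (auto intro!: derivative_eq_intros)
      from DERIV_chain2[OF has_real_derivative_square_pos_part this]
      show "((\<lambda>s. w s y) has_real_derivative k (\<lambda>_. 2) t y) (at t within {0..})"
        by (simp add: w_def k_def mult.commute)
      show "((\<lambda>z. w t z) has_real_derivative k (\<lambda>y. 2 / c y) t y) (at y)"
      proof (cases "y \<in> J")
        case True
        have "((\<lambda>z. t + F z - M) has_real_derivative 1 / c y) (at y)"
          by (auto intro!: derivative_eq_intros F True)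
        from DERIV_chain2[OF has_real_derivative_square_pos_part this]
        have "((\<lambda>z. (max 0 (t + F z - M))\<^sup>2) has_real_derivative k (\<lambda>y. 2 / c y) t y) (at y)"
          using True by (simp add: k_def mult.commute)
        then show ?thesis
          by (rule has_field_derivative_transform_within_open[OF _ J(1) True]) (simp add: w_def)
      next
        case False
        obtain b where b: "y < b" "\<And>z. z < b \<Longrightarrow> z \<in> J \<Longrightarrow> F z < M - t"
          using vanish[OF False] by blast
        have "((\<lambda>_. 0) has_real_derivative k (\<lambda>y. 2 / c y) t y) (at y)"
          using False by (simp add: k_def)
        then show ?thesis
          by (rule has_field_derivative_transform_within_open[of _ _ _ "{..<b}"])
            (use b in \<open>fastforce simp: w_def\<close>)+
      qed
    qed
  qed
  moreover have "w 0 y = 0" for y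
    using bounded by (simp add: w_def)
  \<comment> \<open>At this time the argument of the positive part at \<open>x\<close> equals
    1.\<close>
  moreover have "w (M - F x + 1) x \<noteq> 0" "0 \<le> M - F x + 1"
    using bounded[OF J(3)] J(3) by (simp_all add: w_def)
  ultimately show ?thesis
    unfolding spontaneous_solution_def by blast
qed

text \<open>The alternative is whether \<open>F\<close> is unbounded above on \<open>J\<close>. If
  it is bounded, \<open>J\<close> has no finite right endpoint, since \<open>F\<close> would diverge
  there, and the trajectory escapes to infinity.\<close>

lemma (in C1_field) ode_solution_or_spontaneous_pos:
  assumes "0 < c x"
  shows "(\<exists>y. y 0 = x \<and> (\<forall>T. ode_solution c T y)) \<or> (\<exists>w. spontaneous_solution c w)"
proof (rule quadrature[OF assms])
  fix J F
  assume J: "open J" "connected J" "x \<in> J"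
    and pos: "\<And>y. y \<in> J \<Longrightarrow> 0 < c y"
    and F: "\<And>y. y \<in> J \<Longrightarrow> (F has_real_derivative 1 / c y) (at y)"
    and up: "\<And>z M. x < z \<Longrightarrow> z \<notin> J \<Longrightarrow> \<exists>y\<in>J. M < F y"
    and down: "\<And>z M. z < x \<Longrightarrow> z \<notin> J \<Longrightarrow> \<exists>y\<in>J. F y < M"
  show ?thesis
  proof (cases "\<forall>M. \<exists>y\<in>J. M < F y")
    case True
    then show ?thesis
      using ode_solution_quadrature[OF J pos F] by blast
  next
    case False
    then obtain M where M: "\<And>y. y \<in> J \<Longrightarrow> F y \<le> M"
      by (meson not_less)
    have "z \<in> J" if "x < z" for z
      using up[OF that, of M] M by (meson not_less)
    then have "\<exists>w. spontaneous_solution c w"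
      using J pos F down M by (intro spontaneous_solution_escape) auto
    then show ?thesis ..
  qed
qed

lemma (in C1_field) C1_field_reflect: "C1_field (\<lambda>x. - c (- x)) (\<lambda>x. c' (- x))"
proof
  show "((\<lambda>y. - c (- y)) has_real_derivative c' (- y)) (at y)" for y
    using DERIV_minus[OF DERIV_chain2[OF deriv DERIV_minus[OF DERIV_ident]], of y UNIV] by simp
  show "continuous_on UNIV (\<lambda>y. c' (- y))"
    by (intro continuous_intros continuous_on_compose2[OF cont_deriv]) auto
qed

text \<open>A zero of \<open>c\<close> is a stationary trajectory, and negative speed becomes
  positive speed under reflection.\<close>

lemma (in C1_field) ode_solution_or_spontaneous:
  "(\<exists>y. y 0 = x \<and> (\<forall>T. ode_solution c T y)) \<or> (\<exists>w. spontaneous_solution c w)"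
proof (cases "c x" "0::real" rule: linorder_cases)
  case less
  interpret reflected: C1_field "\<lambda>x. - c (- x)" "\<lambda>x. c' (- x)"
    by (rule C1_field_reflect)
  have "0 < - c (- (- x))"
    using less by simp
  from reflected.ode_solution_or_spontaneous_pos[OF this] show ?thesis
  proof (elim disjE exE conjE)
    fix y assume "y 0 = - x" and y: "\<forall>T. ode_solution (\<lambda>x. - c (- x)) T y"
    have "ode_solution c T (\<lambda>t. - y t)" for T
      using y unfolding ode_solution_def by (auto intro!: derivative_eq_intros)
    with \<open>y 0 = - x\<close> show ?thesis
      by (intro disjI1 exI[of _ "\<lambda>t. - y t"]) simp
  next
    fix w assume w: "spontaneous_solution (\<lambda>x. - c (- x)) w"
    then obtain t x where "0 \<le> t" "w t x \<noteq> 0"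
      unfolding spontaneous_solution_def by blast
    then have "\<exists>t\<ge>0. \<exists>x. w t (- x) \<noteq> 0"
      by (intro exI[of _ t] conjI exI[of _ "- x"]) auto
    with w have "spontaneous_solution c (\<lambda>t x. w t (- x))"
      unfolding spontaneous_solution_def by (auto intro: classical_transport_on_reflect)
    then show ?thesis by blast
  qed
next
  case equal
  then have "ode_solution c T (\<lambda>_. x)" for T
    by (simp add: ode_solution_def)
  then show ?thesis
    by (intro disjI1 exI[of _ "\<lambda>_. x"]) simp
next
  case greater
  then show ?thesis
    by (rule ode_solution_or_spontaneous_pos)
qed

text \<open>Adding a spontaneous solution to \<open>v\<close> would give a second solution with the
  same datum. Hence every point has a global forward trajectory, and choosing one for each point
  gives the flow.\<close>

lemma (in C1_field) complete_flow_exists: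
  assumes "unique_transport_solution c g v"
  obtains X where "complete_flow c c' X"
proof -
  have "\<not> spontaneous_solution c w" for w
  proof
    assume w: "spontaneous_solution c w"
    have "transport_solution c g v"
      and unique: "\<And>v' t x. transport_solution c g v' \<Longrightarrow> 0 \<le> t \<Longrightarrow> v' t x = v t x"
      using assms unfolding unique_transport_solution_def by auto
    with w have "transport_solution c g (\<lambda>t x. v t x + w t x)"
      unfolding spontaneous_solution_def by (auto intro: transport_solution_add_classical)
    from unique[OF this] have "\<And>t x. 0 \<le> t \<Longrightarrow> w t x = 0"
      by simp
    with w show False
      unfolding spontaneous_solution_def by blast
  qed
  then have "\<exists>y. y 0 = x \<and> (\<forall>T. ode_solution c T y)" for x
    using ode_solution_or_spontaneous by blast
  then obtain Y where Y: "\<And>x. Y x 0 = x" "\<And>x T. ode_solution c T (Y x)"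
    by metis
  then have "complete_flow c c' (\<lambda>t x. Y x t)"
    by unfold_locales auto
  then show ?thesis
    by (rule that)
qed

section \<open>From sample solutions to densities\<close>

theorem theorem2p1:
  fixes \<Omega> :: "(real ^ 'd) set"
    and \<mu> :: "(real ^ 'd) measure"
    and c :: "real \<Rightarrow> real"
    and u0 :: "real \<Rightarrow> real ^ 'd \<Rightarrow> real"
    and u :: "real \<Rightarrow> real \<Rightarrow> real ^ 'd \<Rightarrow> real"
    and f0 :: "real \<Rightarrow> real \<Rightarrow> real"
  assumes "prob_space \<mu>"
    and "sets \<mu> = sets (restrict_space borel \<Omega>)"
    and "c C1_differentiable_on UNIV"
    and "\<And>x. u0 x \<in> borel_measurable \<mu>"
    and "\<And>\<omega>. \<omega> \<in> \<Omega> \<Longrightarrow>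
           unique_transport_solution c (\<lambda>x. u0 x \<omega>) (\<lambda>t x. u t x \<omega>)"
    and "\<And>x. is_pdf (pointwise_statistics \<mu> u 0 x) (f0 x)"
    and "\<And>U. piecewise_C1 (\<lambda>x. f0 x U)"
  shows "\<exists>f. is_pdf_family \<mu> u f \<and>
           (\<forall>g. is_pdf_family \<mu> u g \<longrightarrow>
              (\<forall>t\<ge>0. \<forall>x. AE U in lborel. g t x U = f t x U)) \<and>
           (\<forall>U. transport_solution c (\<lambda>x. f0 x U) (\<lambda>t x. f t x U))"
proof -
  have space: "space \<mu> = \<Omega>"
    using sets_eq_imp_space_eq[OF assms(2)] by (simp add: space_restrict_space)
  \<comment> \<open>A single sample suffices to obtain the flow, because the field \<open>c\<close>
    is deterministic; a probability space is nonempty and provides one.\<close>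
  then obtain \<omega>0 where \<omega>0: "\<omega>0 \<in> \<Omega>"
    using prob_space.not_empty[OF assms(1)] by blast
  obtain c' where "C1_field c c'"
    using assms(3) unfolding C1_differentiable_on_def C1_field_def
    by (auto simp: has_real_derivative_iff_has_vector_derivative)
  then obtain X where "complete_flow c c' X"
    using C1_field.complete_flow_exists assms(5)[OF \<omega>0] by blast
  then interpret complete_flow c c' X .
  \<comment> \<open>Stated with \<open>u 0\<close> in place of \<open>u0\<close>, because the
    density \<open>f0\<close> belongs to the statistics of \<open>u 0\<close>.\<close>
  have u: "u t x \<omega> = u 0 (X t x) \<omega>" if "\<omega> \<in> \<Omega>" "0 \<le> t" for \<omega> t x
  proof -
    have sol: "transport_solution c (\<lambda>x. u0 x \<omega>) (\<lambda>t x. u t x \<omega>)"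
      using assms(5)[OF that(1)] by (simp add: unique_transport_solution_def)
    then have "transport_solution c (\<lambda>x. u0 x \<omega>) (\<lambda>t x. u0 (X t x) \<omega>)"
      by (intro transport_solution_flow piecewise_C1_initial_datum)
    with assms(5)[OF that(1)] that(2) have "u t x \<omega> = u0 (X t x) \<omega>"
      unfolding unique_transport_solution_def by metis
    with sol show ?thesis
      by (simp add: transport_solution_def)
  qed
  \<comment> \<open>For fixed \<open>(t, x)\<close> the foot \<open>X t x\<close> is the same for
    all samples, so the two random variables agree on \<open>\<Omega>\<close> and have the same
    law.\<close>
  have "pointwise_statistics \<mu> u t x = pointwise_statistics \<mu> u 0 (X t x)" if "0 \<le> t" for t x
    unfolding pointwise_statistics_def by (rule distr_cong) (simp_all add: space u[OF _ that])
  with assms(6) have pdf: "is_pdf_family \<mu> u (\<lambda>t x. f0 (X t x))"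
    unfolding is_pdf_family_def by metis
  have "AE U in lborel. g t x U = f0 (X t x) U" if g: "is_pdf_family \<mu> u g" and t: "0 \<le> t" for g t x
  proof -
    have g': "is_pdf (pointwise_statistics \<mu> u t x) (g t x)"
      and f': "is_pdf (pointwise_statistics \<mu> u t x) (f0 (X t x))"
      using g pdf t by (auto simp: is_pdf_family_def)
    have "AE U in lborel. ennreal (g t x U) = ennreal (f0 (X t x) U)"
    proof (rule sigma_finite_measure.density_unique_iff[OF sigma_finite_lborel, THEN iffD1])
      show "density lborel (\<lambda>U. ennreal (g t x U)) = density lborel (\<lambda>U. ennreal (f0 (X t x) U))"
        using g' f' unfolding is_pdf_def by metis
    qed (use g' f' in \<open>auto simp: is_pdf_def\<close>)
    \<comment> \<open>Both densities are nonnegative, so equality in \<open>ennreal\<close> gives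
      equality of the real values.\<close>
    then show ?thesis
      using g' f' by (auto simp: is_pdf_def)
  qed
  \<comment> \<open>With \<open>U\<close> as a fixed parameter, \<open>f0\<close> is a piecewise
    smooth datum in \<open>x\<close>, transported by the same flow as the samples.\<close>
  moreover have "transport_solution c (\<lambda>x. f0 x U) (\<lambda>t x. f0 (X t x) U)" for U
    by (rule transport_solution_flow[OF assms(7)])
  ultimately show ?thesis
    using pdf by (intro exI[of _ "\<lambda>t x. f0 (X t x)"]) auto
qed

end
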